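(* Assume the $abc$ Conjecture. For real $X$ define $$E_2(X):=\#\{(x,y)\in\mathbb Z_{\ge 1}\times\mathbb Z:\ x>X^{2/11},\ 1\le |x^{11}-y^2|\le X\},$$ $$E_4(X):=\#\{(x,u)\in\mathbb Z_{\ge 1}\times\mathbb Z:\ x>X^{1/11},\ 1\le |5x^{22}-u^2|\le 4X\}.$$ Then, as $X\to+\infty$: (i) for every $\eta>0$, $E_2(X)\ll_{\eta} X^{4/9+\eta}$; (ii) for every $\eta>0$, $E_4(X)\ll_{\eta} X^{1/5+\eta}$.
   Context: The $abc$ Conjecture is the statement: for every $\varepsilon>0$ there exists a constant $C_\varepsilon>0$ such that for all coprime nonzero integers $a,b,c$ with $a+b=c$ one has $|c|\le C_\varepsilon\,\operatorname{rad}(abc)^{1+\varepsilon}$, where $\operatorname{rad}(abc):=\prod_{p\mid abc}p$ is the product of the distinct primes dividing $abc$. The notation $f(X)\ll_\eta g(X)$ means that there is a constant depending only on $\eta$ such that $|f(X)|$ is at most that constant times $g(X)$ for all sufficiently large $X$ (where "sufficiently large" may depend on $\eta$). *)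

theory Defs
  imports
    Complex_Main
    "HOL-Computational_Algebra.Primes"
    "HOL-Library.Landau_Symbols"
begin

definition rad :: "int \<Rightarrow> int" where
  "rad n = (\<Prod>p\<in>prime_factors n. p)"

definition abc_conjecture :: bool where
  "abc_conjecture \<longleftrightarrow>
     (\<forall>\<epsilon>::real. \<epsilon> > 0 \<longrightarrow>
        (\<exists>C::real. C > 0 \<and>
           (\<forall>a b c :: int.
              a \<noteq> 0 \<longrightarrow> b \<noteq> 0 \<longrightarrow> c \<noteq> 0 \<longrightarrow> Gcd {a, b, c} = 1 \<longrightarrow> a + b = c \<longrightarrow>
              real_of_int \<bar>c\<bar> \<le> C * real_of_int (rad (a * b * c)) powr (1 + \<epsilon>))))"

definition E2_set :: "real \<Rightarrow> (int \<times> int) set" where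
  "E2_set X = {(x, y). x \<ge> 1 \<and> real_of_int x > X powr (2 / 11) \<and>
     1 \<le> \<bar>x ^ 11 - y ^ 2\<bar> \<and> real_of_int \<bar>x ^ 11 - y ^ 2\<bar> \<le> X}"

definition E4_set :: "real \<Rightarrow> (int \<times> int) set" where
  "E4_set X = {(x, u). x \<ge> 1 \<and> real_of_int x > X powr (1 / 11) \<and>
     1 \<le> \<bar>5 * x ^ 22 - u ^ 2\<bar> \<and> real_of_int \<bar>5 * x ^ 22 - u ^ 2\<bar> \<le> 4 * X}"

text \<open>
  Since \<^const>\<open>card\<close> is 0 on infinite sets, a bound on these counts is only meaningful
  together with finiteness of the underlying sets. Both sets are empty for \<open>X \<le> 0\<close>, so the
  values of \<open>powr\<close> at nonpositive arguments play no role.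
\<close>

definition E2 :: "real \<Rightarrow> nat" where
  "E2 X = card (E2_set X)"

definition E4 :: "real \<Rightarrow> nat" where
  "E4 X = card (E4_set X)"

end

theory Submission
  imports Defs "HOL-Number_Theory.Totient"
begin

text \<open>
  The \<open>abc\<close> Conjecture forces \<open>A = m x\<^sup>N\<close> and the square \<open>y\<^sup>2\<close> to be far apart unless they
  coincide. Put \<open>k = \<bar>A - y\<^sup>2\<bar>\<close> and divide the identity \<open>y\<^sup>2 + (A - y\<^sup>2) = A\<close> by
  the greatest common divisor of its terms; the conjecture, applied to the quotients, bounds \<open>A\<close> by
  a constant times \<open>(rad A \<cdot> rad y\<^sup>2 \<cdot> k)\<^bsup>1+\<epsilon>\<^esup>\<close>. Here \<open>rad A \<le> m x\<close>, and
  \<open>rad y\<^sup>2 \<le> \<bar>y\<bar>\<close> is at most a constant times \<open>x\<^bsup>N/2\<^esup>\<close> as long as \<open>k < A\<close>.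
  Solving for \<open>x\<close> gives \<open>x \<le> K k\<^sup>s\<close>, where \<open>s\<close> tends to \<open>1 / (N/2 - 1)\<close> as \<open>\<epsilon> \<rightarrow> 0\<close>:
  this is \<open>abc_base_bound_near_square\<close>.

  A given \<open>x\<close> belongs to boundedly many \<open>y\<close>, because the lower bounds imposed on \<open>x\<close> make \<open>A\<close>
  exceed a multiple of \<open>X\<^sup>2\<close>: the admissible squares lie in an interval of length \<open>O(X)\<close> around a
  number of size at least \<open>X\<^sup>2\<close>, so their roots spread by \<open>O(1)\<close> only
  (\<open>card_near_square_le\<close>). Hence the two counts are \<open>O(X\<^sup>s)\<close>
  with \<open>s\<close> close to \<open>2/9\<close> for \<open>N = 11\<close> and close to \<open>1/10\<close> for \<open>N = 22\<close>. The required exponents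
  \<open>4/9\<close> and \<open>1/5\<close> are twice as large, so there is no need to let \<open>\<epsilon>\<close> tend to \<open>0\<close>: the single value
  \<open>\<epsilon> = 1/4\<close> already gives \<open>10/23 < 4/9\<close> and \<open>5/28 < 1/5\<close>.
\<close>

section \<open>The radical of an integer\<close>

lemma rad_pos: "rad n > 0"
  unfolding rad_def by (rule prod_pos) (auto dest: in_prime_factors_imp_prime prime_gt_0_int)

lemma rad_mult_le:
  assumes "a \<noteq> 0" "b \<noteq> 0"
  shows "rad (a * b) \<le> rad a * rad b"
proof -
  let ?A = "prime_factors a" and ?B = "prime_factors b"
  have "(\<Prod>p\<in>?B - ?A. p) \<le> (\<Prod>p\<in>?B - ?A. p) * (\<Prod>p\<in>?A \<inter> ?B. p)"
  proof -
    have "(\<Prod>p\<in>?B - ?A. p) \<ge> 0" "(\<Prod>p\<in>?A \<inter> ?B. p) \<ge> 1"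
      by (auto intro!: prod_nonneg prod_ge_1 dest: in_prime_factors_imp_prime
               simp: prime_ge_0_int prime_ge_1_int)
    thus ?thesis by (simp add: mult_le_cancel_left1)
  qed
  also have "\<dots> = rad b"
    unfolding rad_def by (subst prod.union_disjoint [symmetric]) (auto intro!: prod.cong)
  finally have B: "(\<Prod>p\<in>?B - ?A. p) \<le> rad b" .
  have "rad (a * b) = (\<Prod>p\<in>?A \<union> (?B - ?A). p)"
    unfolding rad_def using assms by (simp add: prime_factors_product)
  also have "\<dots> = rad a * (\<Prod>p\<in>?B - ?A. p)"
    unfolding rad_def by (rule prod.union_disjoint) auto
  also have "\<dots> \<le> rad a * rad b"
    using B rad_pos [of a] by simp
  finally show ?thesis .
qed

lemma rad_power: "n > 0 \<Longrightarrow> rad (a ^ n) = rad a"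
  unfolding rad_def by (simp add: prime_factors_power)

lemma rad_mono_dvd:
  assumes "a dvd b" "b \<noteq> 0"
  shows "rad a \<le> rad b"
  unfolding rad_def
proof (rule prod_mono2)
  show "prime_factors a \<subseteq> prime_factors b"
    using assms by (rule dvd_prime_factors [rotated])
qed (auto dest: in_prime_factors_imp_prime simp: prime_ge_0_int prime_ge_1_int)

lemma rad_le_abs:
  assumes "n \<noteq> 0"
  shows "rad n \<le> \<bar>n\<bar>"
proof -
  have "rad n \<le> (\<Prod>p\<in>prime_factors n. p ^ multiplicity p n)"
    unfolding rad_def
  proof (rule prod_mono)
    fix p assume p: "p \<in> prime_factors n"
    hence "p ^ 1 \<le> p ^ multiplicity p n"
      by (intro power_increasing)
         (auto simp: prime_factors_multiplicity prime_ge_1_int)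
    thus "0 \<le> p \<and> p \<le> p ^ multiplicity p n"
      using p by (auto dest: in_prime_factors_imp_prime simp: prime_ge_0_int)
  qed
  also have "\<dots> = \<bar>n\<bar>"
    using prod_prime_factors [OF assms] by simp
  finally show ?thesis .
qed

section \<open>The gap between multiples of powers and squares\<close>

text \<open>
  A common factor of \<open>a\<close> and \<open>b\<close> does no harm: dividing by \<open>g = gcd a b\<close> shrinks the left-hand
  side by the factor \<open>g\<close>, but \<open>\<bar>a - b\<bar>\<close> shrinks by \<open>g\<close> too and occurs on the right with an
  exponent at least \<open>1\<close>.
\<close>

lemma abc_difference_bound:
  assumes abc: "abc_conjecture" and \<epsilon>: "\<epsilon> > 0"
  obtains C :: real where "C > 0"
    "\<And>a b :: int. \<lbrakk>a \<noteq> 0; b \<noteq> 0; a \<noteq> b\<rbrakk> \<Longrightarrow>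
       real_of_int \<bar>a\<bar> \<le> C * real_of_int (rad a * rad b * \<bar>a - b\<bar>) powr (1 + \<epsilon>)"
proof -
  obtain C where C: "C > 0" and bound: "\<And>a b c :: int. \<lbrakk>a \<noteq> 0; b \<noteq> 0; c \<noteq> 0; Gcd {a, b, c} = 1; a + b = c\<rbrakk>
      \<Longrightarrow> real_of_int \<bar>c\<bar> \<le> C * real_of_int (rad (a * b * c)) powr (1 + \<epsilon>)"
    using abc \<epsilon> unfolding abc_conjecture_def by metis
  show thesis
  proof (rule that [OF C])
    fix a b :: int
    assume nz: "a \<noteq> 0" "b \<noteq> 0" "a \<noteq> b"
    define g where "g = gcd a b"
    have g: "g > 0" using nz by (simp add: g_def)
    obtain a' b' where ab: "a = g * a'" "b = g * b'"
      unfolding g_def by (meson dvdE gcd_dvd1 gcd_dvd2)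
    have cop: "gcd a' b' = 1"
    proof -
      have "g * gcd a' b' = g" using g ab by (metis abs_of_pos g_def gcd_mult_distrib_int)
      thus ?thesis using g by simp
    qed
    have nz': "a' \<noteq> 0" "b' \<noteq> 0" "a' - b' \<noteq> 0" using nz ab by auto
    have "gcd b' (gcd (a' - b') a') = 1"
      using cop by (metis gcd.assoc gcd.commute gcd_1_int)
    hence "Gcd {b', a' - b', a'} = 1" by simp
    hence 1: "real_of_int \<bar>a'\<bar> \<le> C * real_of_int (rad (b' * (a' - b') * a')) powr (1 + \<epsilon>)"
      using nz' by (intro bound) auto
    let ?R = "real_of_int (rad a * rad b * \<bar>a - b\<bar>)"
    have "g * rad (b' * (a' - b') * a') \<le> rad a * rad b * \<bar>a - b\<bar>"
    proof -
      have "rad (b' * (a' - b') * a') \<le> rad (b' * (a' - b')) * rad a'"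
        using nz' by (intro rad_mult_le) auto
      also have "\<dots> \<le> (rad b' * rad (a' - b')) * rad a'"
        using nz' rad_pos [of a'] by (intro mult_right_mono rad_mult_le) auto
      also have "\<dots> \<le> (rad b * \<bar>a' - b'\<bar>) * rad a"
        using nz nz' ab rad_pos
        by (intro mult_mono rad_mono_dvd rad_le_abs) (auto intro: less_imp_le)
      finally have "g * rad (b' * (a' - b') * a') \<le> g * ((rad b * \<bar>a' - b'\<bar>) * rad a)"
        using g by simp
      also have "\<dots> = rad a * rad b * (g * \<bar>a' - b'\<bar>)" by simp
      also have "g * \<bar>a' - b'\<bar> = \<bar>a - b\<bar>"
        using g by (simp add: ab abs_mult flip: right_diff_distrib)
      finally show ?thesis .
    qed
    hence "real_of_int (g * rad (b' * (a' - b') * a')) \<le> ?R" by (rule of_int_le_iff [THEN iffD2])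
    hence R: "real_of_int g * real_of_int (rad (b' * (a' - b') * a')) \<le> ?R" by simp
    have "real_of_int \<bar>a\<bar> = real_of_int g powr 1 * real_of_int \<bar>a'\<bar>"
      using g by (simp add: ab abs_mult)
    also have "\<dots> \<le> real_of_int g powr (1 + \<epsilon>) *
                     (C * real_of_int (rad (b' * (a' - b') * a')) powr (1 + \<epsilon>))"
      using g \<epsilon> by (intro mult_mono 1 powr_mono) auto
    also have "\<dots> = C * (real_of_int g * real_of_int (rad (b' * (a' - b') * a'))) powr (1 + \<epsilon>)"
      using g rad_pos [of "b' * (a' - b') * a'"] by (simp add: powr_mult)
    also have "\<dots> \<le> C * ?R powr (1 + \<epsilon>)"
      using C g \<epsilon> R rad_pos [of "b' * (a' - b') * a'"]
      by (intro mult_left_mono powr_mono2) auto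
    finally show "real_of_int \<bar>a\<bar> \<le> C * ?R powr (1 + \<epsilon>)" .
  qed
qed

text \<open>
  The exponent \<open>N - (1 + \<epsilon>) (N/2 + 1)\<close> is what remains of \<open>x\<^sup>N\<close> after the radical of \<open>m x\<^sup>N y\<^sup>2\<close>,
  which is of order at most \<open>x\<^bsup>N/2 + 1\<^esup>\<close>, has been moved to the other side with the
  exponent \<open>1 + \<epsilon>\<close>. The inequality bounds \<open>x\<close> exactly when something is left, that is, when \<open>e > 0\<close>.
\<close>

lemma abc_base_bound_near_square:
  fixes m :: int and N :: nat and \<epsilon> s :: real
  defines "e \<equiv> real N - (1 + \<epsilon>) * (real N / 2 + 1)"
  assumes abc: "abc_conjecture" and \<epsilon>: "\<epsilon> > 0" and m: "m > 0" and N: "N > 0" and e: "e > 0"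
    and s: "s = (1 + \<epsilon>) / e"
  obtains K :: real where "K > 0"
    "\<And>x y :: int. \<And>T :: real. \<lbrakk>x \<ge> 1; m * x ^ N \<noteq> y\<^sup>2; real_of_int \<bar>m * x ^ N - y\<^sup>2\<bar> \<le> T;
       T < real_of_int (m * x ^ N)\<rbrakk> \<Longrightarrow> real_of_int x \<le> K * T powr s"
proof -
  obtain C where C: "C > 0" and bound: "\<And>a b :: int. \<lbrakk>a \<noteq> 0; b \<noteq> 0; a \<noteq> b\<rbrakk> \<Longrightarrow>
       real_of_int \<bar>a\<bar> \<le> C * real_of_int (rad a * rad b * \<bar>a - b\<bar>) powr (1 + \<epsilon>)"
    using abc_difference_bound [OF abc \<epsilon>] by blast
  define D where "D = C * (real_of_int m * sqrt (2 * real_of_int m)) powr (1 + \<epsilon>)"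
  have D: "D > 0" using C m by (simp add: D_def)
  show thesis
  proof (rule that [of "D powr (1 / e)"])
    show "D powr (1 / e) > 0" using D by simp
  next
    fix x y :: int and T :: real
    assume x: "x \<ge> 1" and ne: "m * x ^ N \<noteq> y\<^sup>2"
      and kT: "real_of_int \<bar>m * x ^ N - y\<^sup>2\<bar> \<le> T" and T: "T < real_of_int (m * x ^ N)"
    let ?x = "real_of_int x" and ?m = "real_of_int m"
    have T0: "T \<ge> 0" using kT by linarith
    have y0: "y \<noteq> 0"
    proof
      assume "y = 0"
      moreover have "m * x ^ N > 0" using m x by simp
      ultimately have "\<bar>m * x ^ N - y\<^sup>2\<bar> = m * x ^ N" by simp
      with kT T show False by linarith
    qed
    have "rad (m * x ^ N) \<le> rad m * rad (x ^ N)"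
      using m x by (intro rad_mult_le) auto
    also have "\<dots> = rad m * rad x" using N by (simp add: rad_power)
    also have "\<dots> \<le> m * x"
      using m x rad_le_abs [of m] rad_le_abs [of x] rad_pos [of m] rad_pos [of x]
      by (intro mult_mono) auto
    finally have radA: "rad (m * x ^ N) \<le> m * x" .
    have rady: "rad (y\<^sup>2) \<le> \<bar>y\<bar>" using rad_le_abs [OF y0] by (simp add: rad_power)
    have "real_of_int \<bar>y\<bar> \<le> sqrt (2 * (?m * ?x ^ N))"
    proof (rule real_le_rsqrt)
      have "real_of_int (y\<^sup>2) \<le> real_of_int (m * x ^ N) + T"
        using kT by linarith
      thus "(real_of_int \<bar>y\<bar>)\<^sup>2 \<le> 2 * (?m * ?x ^ N)"
        using T by simp
    qed
    also have "\<dots> = sqrt (2 * ?m) * ?x powr (real N / 2)"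
    proof -
      have "sqrt (?x ^ N) = ?x powr (real N / 2)"
        using x by (simp add: powr_half_sqrt [symmetric] powr_powr flip: powr_realpow)
      thus ?thesis by (simp add: real_sqrt_mult)
    qed
    finally have y: "real_of_int \<bar>y\<bar> \<le> sqrt (2 * ?m) * ?x powr (real N / 2)" .
    let ?R = "real_of_int (rad (m * x ^ N) * rad (y\<^sup>2) * \<bar>m * x ^ N - y\<^sup>2\<bar>)"
    have "?R = real_of_int (rad (m * x ^ N)) * real_of_int (rad (y\<^sup>2)) *
               real_of_int \<bar>m * x ^ N - y\<^sup>2\<bar>"
      by simp
    also have "\<dots> \<le> (?m * ?x) * (sqrt (2 * ?m) * ?x powr (real N / 2)) * T"
    proof (intro mult_mono kT)
      show "real_of_int (rad (m * x ^ N)) \<le> ?m * ?x"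
        using radA by (metis of_int_le_iff of_int_mult)
      show "real_of_int (rad (y\<^sup>2)) \<le> sqrt (2 * ?m) * ?x powr (real N / 2)"
        using rady y by linarith
    qed (use m x rad_pos in \<open>auto intro: less_imp_le\<close>)
    also have "\<dots> = (?m * sqrt (2 * ?m)) * ?x powr (real N / 2 + 1) * T"
      using x by (simp add: powr_add)
    finally have R: "?R \<le> (?m * sqrt (2 * ?m)) * ?x powr (real N / 2 + 1) * T" .
    have "?x powr real N \<le> real_of_int \<bar>m * x ^ N\<bar>"
      using m x by (simp add: powr_realpow abs_mult)
    also have "\<dots> \<le> C * ?R powr (1 + \<epsilon>)"
      using m x y0 ne by (intro bound) auto
    also have "\<dots> \<le> C * ((?m * sqrt (2 * ?m)) * ?x powr (real N / 2 + 1) * T) powr (1 + \<epsilon>)"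
      using C \<epsilon> rad_pos [of "m * x ^ N"] rad_pos [of "y\<^sup>2"]
      by (intro mult_left_mono powr_mono2 R) auto
    also have "\<dots> = D * T powr (1 + \<epsilon>) * ?x powr ((1 + \<epsilon>) * (real N / 2 + 1))"
      using m x T0 by (simp add: D_def powr_mult powr_powr mult_ac)
    finally have "?x powr real N / ?x powr ((1 + \<epsilon>) * (real N / 2 + 1)) \<le> D * T powr (1 + \<epsilon>)"
      using x by (simp add: divide_le_eq)
    hence "?x powr e \<le> D * T powr (1 + \<epsilon>)"
      by (simp add: e_def powr_diff)
    hence "(?x powr e) powr (1 / e) \<le> (D * T powr (1 + \<epsilon>)) powr (1 / e)"
      using e by (intro powr_mono2) auto
    thus "?x \<le> D powr (1 / e) * T powr s"
      using x e D T0 by (simp add: powr_powr powr_mult s)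
  qed
qed

section \<open>Counting near-squares\<close>

lemma finite_near_square: "finite {y :: int. real_of_int \<bar>A - y\<^sup>2\<bar> \<le> T}"
proof (rule finite_subset)
  show "{y. real_of_int \<bar>A - y\<^sup>2\<bar> \<le> T} \<subseteq> {-(\<bar>A\<bar> + \<lceil>T\<rceil>)..\<bar>A\<bar> + \<lceil>T\<rceil>}"
  proof
    fix y assume "y \<in> {y. real_of_int \<bar>A - y\<^sup>2\<bar> \<le> T}"
    hence "real_of_int \<bar>A - y\<^sup>2\<bar> \<le> T" by simp
    hence "\<bar>A - y\<^sup>2\<bar> \<le> \<lceil>T\<rceil>" by linarith
    moreover have "\<bar>y\<bar> \<le> y\<^sup>2"
      using self_le_power [of "\<bar>y\<bar>" 2] by (cases "y = 0") auto
    ultimately show "y \<in> {-(\<bar>A\<bar> + \<lceil>T\<rceil>)..\<bar>A\<bar> + \<lceil>T\<rceil>}" by auto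
  qed
qed simp

text \<open>
  The hypothesis forces every \<open>y\<close> in the set to satisfy \<open>\<bar>y\<bar> \<ge> T/4\<close>. Two such squares differ by at
  most \<open>2 T\<close>, so the absolute values of their roots differ by at most \<open>2 T / (T/4 + T/4) = 4\<close>.
\<close>

lemma card_near_square_le:
  fixes A :: int and T :: real
  assumes T: "T > 0" and A: "T + (T / 4)\<^sup>2 \<le> real_of_int A"
  shows "card {y :: int. real_of_int \<bar>A - y\<^sup>2\<bar> \<le> T} \<le> 18" (is "card ?Y \<le> _")
proof (cases "?Y = {}")
  case False
  then obtain z where z: "z \<in> ?Y" by blast
  have large: "\<bar>real_of_int y\<bar> \<ge> T / 4" if "y \<in> ?Y" for y
  proof (rule power2_le_imp_le)
    have "real_of_int \<bar>A - y\<^sup>2\<bar> \<le> T" using that by simp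
    hence "real_of_int A - (real_of_int y)\<^sup>2 \<le> T" by simp
    thus "(T / 4)\<^sup>2 \<le> \<bar>real_of_int y\<bar>\<^sup>2" using A by simp
  qed simp
  have near: "\<bar>real_of_int y\<bar> - \<bar>real_of_int z\<bar> \<le> 4" if "y \<in> ?Y" "z \<in> ?Y" for y z
  proof (rule ccontr)
    let ?y = "\<bar>real_of_int y\<bar>" and ?z = "\<bar>real_of_int z\<bar>"
    assume "\<not> ?y - ?z \<le> 4"
    hence "4 * (T / 2) < (?y - ?z) * (?y + ?z)"
      using large [OF that(1)] large [OF that(2)] T by (intro mult_less_le_imp_less) auto
    also have "\<dots> = (real_of_int y)\<^sup>2 - (real_of_int z)\<^sup>2"
      by (simp add: power2_eq_square algebra_simps)
    also have "\<dots> \<le> 2 * T"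
    proof -
      have "real_of_int \<bar>A - y\<^sup>2\<bar> \<le> T" "real_of_int \<bar>A - z\<^sup>2\<bar> \<le> T" using that by auto
      thus ?thesis by simp
    qed
    finally show False by simp
  qed
  have "?Y \<subseteq> {z - 4..z + 4} \<union> {-z - 4..-z + 4}"
  proof
    fix y assume "y \<in> ?Y"
    with near [OF this z] near [OF z this] have "\<bar>y\<bar> - \<bar>z\<bar> \<le> 4" "\<bar>z\<bar> - \<bar>y\<bar> \<le> 4"
      by linarith+
    thus "y \<in> {z - 4..z + 4} \<union> {-z - 4..-z + 4}" by auto
  qed
  hence "card ?Y \<le> card ({z - 4..z + 4} \<union> {-z - 4..-z + 4})"
    by (rule card_mono [rotated]) simp
  also have "\<dots> \<le> card {z - 4..z + 4} + card {-z - 4..-z + 4}" by (rule card_Un_le)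
  also have "\<dots> = 18" by simp
  finally show ?thesis .
qed auto

text \<open>
  The cut-off \<open>L\<close> is a separate parameter because finiteness has to hold for every \<open>T\<close>, whereas
  the quadratic lower bound on \<open>m x\<^sup>N\<close> that a count requires is only available for large \<open>T\<close>.
\<close>

definition near_square_pairs :: "int \<Rightarrow> nat \<Rightarrow> real \<Rightarrow> real \<Rightarrow> (int \<times> int) set" where
  "near_square_pairs m N T L = {(x, y). x \<ge> 1 \<and> m * x ^ N \<noteq> y\<^sup>2 \<and>
     real_of_int \<bar>m * x ^ N - y\<^sup>2\<bar> \<le> T \<and> L < real_of_int (m * x ^ N)}"

lemma abc_count_near_squares:
  fixes m :: int and N :: nat and \<epsilon> s :: real
  defines "e \<equiv> real N - (1 + \<epsilon>) * (real N / 2 + 1)"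
  assumes "abc_conjecture" "\<epsilon> > 0" "m > 0" "N > 0" "e > 0" "s = (1 + \<epsilon>) / e"
  obtains K :: real where "K > 0"
    "\<And>T L. L \<ge> T \<Longrightarrow> finite (near_square_pairs m N T L)"
    "\<And>T. T > 0 \<Longrightarrow> real (card (near_square_pairs m N T (T + (T / 4)\<^sup>2))) \<le> K * T powr s"
proof -
  obtain K where K: "K > 0" and bound:
    "\<And>x y :: int. \<And>T :: real. \<lbrakk>x \<ge> 1; m * x ^ N \<noteq> y\<^sup>2; real_of_int \<bar>m * x ^ N - y\<^sup>2\<bar> \<le> T;
       T < real_of_int (m * x ^ N)\<rbrakk> \<Longrightarrow> real_of_int x \<le> K * T powr s"
    using abc_base_bound_near_square [of \<epsilon> m N s] assms unfolding e_def by blast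
  let ?Y = "\<lambda>T x. {y. real_of_int \<bar>m * x ^ N - y\<^sup>2\<bar> \<le> T}"
  define B where "B T L = {x \<in> {1..\<lfloor>K * T powr s\<rfloor>}. L < real_of_int (m * x ^ N)}" for T L
  have fin_B: "finite (B T L)" for T L
    by (rule finite_subset [of _ "{1..\<lfloor>K * T powr s\<rfloor>}"]) (auto simp: B_def)
  have sub: "near_square_pairs m N T L \<subseteq> (SIGMA x:B T L. ?Y T x)" if "L \<ge> T" for T L
  proof
    fix p assume "p \<in> near_square_pairs m N T L"
    then obtain x y where p: "p = (x, y)" and xy: "x \<ge> 1" "m * x ^ N \<noteq> y\<^sup>2"
      "real_of_int \<bar>m * x ^ N - y\<^sup>2\<bar> \<le> T" "L < real_of_int (m * x ^ N)"
      unfolding near_square_pairs_def by blast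
    have "real_of_int x \<le> K * T powr s" using xy that by (intro bound) auto
    thus "p \<in> (SIGMA x:B T L. ?Y T x)" using xy by (simp add: p B_def le_floor_iff)
  qed
  have fin_Sigma: "finite (SIGMA x:B T L. ?Y T x)" for T L
    by (intro finite_SigmaI fin_B finite_near_square)
  show thesis
  proof (rule that [of "18 * K"])
    show "18 * K > 0" using K by simp
    show "finite (near_square_pairs m N T L)" if "L \<ge> T" for T L
      using sub [OF that] fin_Sigma by (rule finite_subset)
    fix T :: real assume T: "T > 0"
    let ?L = "T + (T / 4)\<^sup>2"
    have "card (near_square_pairs m N T ?L) \<le> card (SIGMA x:B T ?L. ?Y T x)"
      by (intro card_mono fin_Sigma sub) simp
    also have "\<dots> = (\<Sum>x\<in>B T ?L. card (?Y T x))"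
      by (intro card_SigmaI fin_B ballI finite_near_square)
    also have "\<dots> \<le> (\<Sum>x\<in>B T ?L. 18)"
      using T by (intro sum_mono card_near_square_le) (auto simp: B_def)
    also have "\<dots> = 18 * card (B T ?L)" by simp
    also have "\<dots> \<le> 18 * card {1..\<lfloor>K * T powr s\<rfloor>}"
      by (intro mult_left_mono card_mono) (auto simp: B_def)
    finally have "real (card (near_square_pairs m N T ?L)) \<le> 18 * real (nat \<lfloor>K * T powr s\<rfloor>)"
      by simp
    also have "real (nat \<lfloor>K * T powr s\<rfloor>) \<le> K * T powr s"
      using K by (intro of_nat_floor) simp
    finally show "real (card (near_square_pairs m N T ?L)) \<le> 18 * K * T powr s" by simp
  qed
qed

section \<open>The two families of the theorem\<close>

lemma bigo_powr_of_bound: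
  fixes f :: "real \<Rightarrow> nat"
  assumes "\<And>X. X \<ge> 2 \<Longrightarrow> real (f X) \<le> K * (c * X) powr s" "c > 0" "K > 0" "s \<le> t"
  shows "(\<lambda>X. real (f X)) \<in> O[at_top](\<lambda>X. X powr t)"
proof (rule bigoI [where c = "K * c powr s"])
  show "\<forall>\<^sub>F X in at_top. norm (real (f X)) \<le> K * c powr s * norm (X powr t)"
    using eventually_ge_at_top [of 2]
  proof eventually_elim
    case (elim X)
    have "real (f X) \<le> K * (c * X) powr s" using assms(1) elim .
    also have "\<dots> = K * c powr s * X powr s" using assms elim by (simp add: powr_mult)
    also have "\<dots> \<le> K * c powr s * X powr t"
      using assms elim by (intro mult_left_mono powr_mono) auto
    finally show ?case by simp
  qed
qed

text \<open>
  The lower cut-off on \<open>x\<close> is what makes \<open>x\<^bsup>11\<^esup>\<close> exceed \<open>X\<^sup>2\<close>, and hence \<open>X\<close> itself: a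
  nonempty set has \<open>X \<ge> 1\<close>.
\<close>

lemma E2_set_subset_near_square_pairs:
  assumes L: "L \<le> X \<or> L \<le> X\<^sup>2"
  shows "E2_set X \<subseteq> near_square_pairs 1 11 X L"
proof
  fix p assume p: "p \<in> E2_set X"
  obtain x y where xy: "p = (x, y)" by (cases p)
  have x: "x \<ge> 1" "X powr (2 / 11) < real_of_int x" and pos: "1 \<le> \<bar>x ^ 11 - y\<^sup>2\<bar>"
    and le: "real_of_int \<bar>x ^ 11 - y\<^sup>2\<bar> \<le> X"
    using p unfolding xy E2_set_def by blast+
  have "X \<ge> 1" using pos le by linarith
  hence "(X powr (2 / 11)) ^ 11 = X\<^sup>2" by (simp add: powr_power)
  moreover have "(X powr (2 / 11)) ^ 11 < real_of_int x ^ 11"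
    using x by (intro power_strict_mono) simp_all
  ultimately have "X\<^sup>2 < real_of_int x ^ 11" by linarith
  moreover have "X \<le> X\<^sup>2" using \<open>X \<ge> 1\<close> by (simp add: self_le_power)
  ultimately have "L < real_of_int x ^ 11" using L by linarith
  moreover have "x ^ 11 \<noteq> y\<^sup>2" using pos by linarith
  ultimately show "p \<in> near_square_pairs 1 11 X L"
    unfolding xy near_square_pairs_def mem_Collect_eq prod.case mult_1 of_int_power
    using x(1) le by blast
qed

text \<open>
  Here a nonempty set only has \<open>X \<ge> 1/4\<close>, so that \<open>X \<le> X\<^sup>2\<close> may fail; but \<open>x\<^bsup>22\<^esup>\<close> is also at
  least \<open>x\<^bsup>11\<^esup>\<close>, which exceeds \<open>X\<close>.
\<close>

lemma E4_set_subset_near_square_pairs: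
  assumes L: "L \<le> 4 * X \<or> L \<le> 5 * X\<^sup>2"
  shows "E4_set X \<subseteq> near_square_pairs 5 22 (4 * X) L"
proof
  fix p assume p: "p \<in> E4_set X"
  obtain x u where xu: "p = (x, u)" by (cases p)
  have x: "x \<ge> 1" "X powr (1 / 11) < real_of_int x" and pos: "1 \<le> \<bar>5 * x ^ 22 - u\<^sup>2\<bar>"
    and le: "real_of_int \<bar>5 * x ^ 22 - u\<^sup>2\<bar> \<le> 4 * X"
    using p unfolding xu E4_set_def by blast+
  have "X > 0" using pos le by linarith
  hence "(X powr (1 / 11)) ^ 11 = X" by (simp add: powr_power)
  moreover have "(X powr (1 / 11)) ^ 11 < real_of_int x ^ 11"
    using x by (intro power_strict_mono) simp_all
  ultimately have X: "X < real_of_int x ^ 11" by linarith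
  hence "X\<^sup>2 < (real_of_int x ^ 11)\<^sup>2"
    using \<open>X > 0\<close> by (intro power_strict_mono) simp_all
  hence "X\<^sup>2 < real_of_int x ^ 22" by (simp flip: power_mult)
  moreover have "real_of_int x ^ 11 \<le> real_of_int x ^ 22"
    using x by (intro power_increasing) simp_all
  ultimately have "L < 5 * real_of_int x ^ 22" using L X \<open>X > 0\<close> by linarith
  hence "L < real_of_int (5 * x ^ 22)" by simp
  moreover have "5 * x ^ 22 \<noteq> u\<^sup>2" using pos by linarith
  ultimately show "p \<in> near_square_pairs 5 22 (4 * X) L"
    unfolding xu near_square_pairs_def mem_Collect_eq prod.case using x(1) le by blast
qed

theorem lemma5:
  assumes "abc_conjecture"
  shows "(\<forall>X. finite (E2_set X)) \<and>
         (\<forall>\<eta>::real. \<eta> > 0 \<longrightarrow> (\<lambda>X. real (E2 X)) \<in> O[at_top](\<lambda>X. X powr (4 / 9 + \<eta>))) \<and>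
         (\<forall>X. finite (E4_set X)) \<and>
         (\<forall>\<eta>::real. \<eta> > 0 \<longrightarrow> (\<lambda>X. real (E4 X)) \<in> O[at_top](\<lambda>X. X powr (1 / 5 + \<eta>)))"
proof (intro conjI allI impI)
  obtain K where K: "K > 0"
    and fin: "\<And>T L. L \<ge> T \<Longrightarrow> finite (near_square_pairs 1 11 T L)"
    and count: "\<And>T. T > 0 \<Longrightarrow>
      real (card (near_square_pairs 1 11 T (T + (T / 4)\<^sup>2))) \<le> K * T powr (10 / 23)"
    by (rule abc_count_near_squares [OF assms, of "1 / 4" 1 11 "10 / 23"]) simp_all
  show "finite (E2_set X)" for X
    using E2_set_subset_near_square_pairs [of X X] fin [of X X] by (blast intro: finite_subset)
  have "real (E2 X) \<le> K * (1 * X) powr (10 / 23)" if "X \<ge> 2" for X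
  proof -
    let ?P = "near_square_pairs 1 11 X (X + (X / 4)\<^sup>2)"
    have "2 * X \<le> X\<^sup>2"
      using mult_right_mono [OF that, of X] that by (simp add: power2_eq_square)
    hence "X + (X / 4)\<^sup>2 \<le> X\<^sup>2"
      using that by (simp add: power_divide)
    hence "E2_set X \<subseteq> ?P"
      by (intro E2_set_subset_near_square_pairs disjI2)
    moreover have "finite ?P" by (rule fin) simp
    ultimately have "card (E2_set X) \<le> card ?P" by (intro card_mono)
    moreover have "real (card ?P) \<le> K * X powr (10 / 23)"
      using that by (intro count) simp
    ultimately show ?thesis unfolding E2_def by simp
  qed
  thus "(\<lambda>X. real (E2 X)) \<in> O[at_top](\<lambda>X. X powr (4 / 9 + \<eta>))" if "\<eta> > 0" for \<eta>
    by (rule bigo_powr_of_bound) (use K that in simp_all)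
next
  obtain K where K: "K > 0"
    and fin: "\<And>T L. L \<ge> T \<Longrightarrow> finite (near_square_pairs 5 22 T L)"
    and count: "\<And>T. T > 0 \<Longrightarrow>
      real (card (near_square_pairs 5 22 T (T + (T / 4)\<^sup>2))) \<le> K * T powr (5 / 28)"
    by (rule abc_count_near_squares [OF assms, of "1 / 4" 5 22 "5 / 28"]) simp_all
  show "finite (E4_set X)" for X
    using E4_set_subset_near_square_pairs [of "4 * X" X] fin [of "4 * X" "4 * X"]
    by (blast intro: finite_subset)
  have "real (E4 X) \<le> K * (4 * X) powr (5 / 28)" if "X \<ge> 2" for X
  proof -
    let ?P = "near_square_pairs 5 22 (4 * X) (4 * X + (4 * X / 4)\<^sup>2)"
    have "2 * X \<le> X\<^sup>2"
      using mult_right_mono [OF that, of X] that by (simp add: power2_eq_square)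
    hence "4 * X + (4 * X / 4)\<^sup>2 \<le> 5 * X\<^sup>2"
      using that by (simp add: power_divide)
    hence "E4_set X \<subseteq> ?P"
      by (intro E4_set_subset_near_square_pairs disjI2)
    moreover have "finite ?P" by (rule fin) simp
    ultimately have "card (E4_set X) \<le> card ?P" by (intro card_mono)
    moreover have "real (card ?P) \<le> K * (4 * X) powr (5 / 28)"
      using that by (intro count) simp
    ultimately show ?thesis unfolding E4_def by simp
  qed
  thus "(\<lambda>X. real (E4 X)) \<in> O[at_top](\<lambda>X. X powr (1 / 5 + \<eta>))" if "\<eta> > 0" for \<eta>
    by (rule bigo_powr_of_bound) (use K that in simp_all)
qed

end
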